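(* Let $\underline u,\underline v,\underline w\in\{-1,+1\}^n$ with $\underline v\ne\underline u$ and $\underline w\neq\underline u$, and let $\theta\in[0,\pi]$ be the angle formed by the two vectors $\underline v-\underline u$ and $\underline w-\underline u$ in $\mathbb R^n$. Then $$\theta\le\min\Big\{\frac\pi2,\ \arccos\sqrt{\frac{d_1}{n}}+\arccos\sqrt{\frac{d_2}{n}}\Big\},$$ where $d_1=d_H(\underline u,\underline v)$ and $d_2=d_H(\underline u,\underline w)$.
   Context: $d_H$ denotes the Hamming distance, i.e. the number of coordinates in which two vectors differ. *)

theory Defs
  imports "HOL-Analysis.Analysis"
begin

definition hamming_dist :: "'a ^ 'n \<Rightarrow> 'a ^ 'n \<Rightarrow> nat"
  where "hamming_dist x y = card {i. x $ i \<noteq> y $ i}"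

(* Only meaningful for nonzero arguments; if one argument is zero, the quotient is 0 by
   convention and the value is pi / 2. *)
definition vector_angle :: "'a :: real_inner \<Rightarrow> 'a \<Rightarrow> real"
  where "vector_angle x y = arccos (x \<bullet> y / (norm x * norm y))"

lemma abs_inner_div_norm_le_1: "\<bar>x \<bullet> y / (norm x * norm y)\<bar> \<le> 1"
  using Cauchy_Schwarz_ineq2[of x y]
  by (cases "norm x * norm y = 0") (auto simp: abs_mult divide_le_eq_1)

lemma vector_angle_bounds: "vector_angle x y \<in> {0..pi}"
  using abs_le_D1[OF abs_inner_div_norm_le_1, of x y] abs_le_D2[OF abs_inner_div_norm_le_1, of x y]
  unfolding vector_angle_def atLeastAtMost_iff by (intro conjI arccos_lbound arccos_ubound) linarith+

lemma inner_eq_cos_vector_angle: "x \<bullet> y = norm x * norm y * cos (vector_angle x y)"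
  unfolding vector_angle_def cos_arccos_abs[OF abs_inner_div_norm_le_1] by auto

end

theory Submission
  imports Defs
begin

text \<open>
  Every coordinate of \<open>v - u\<close> and of \<open>w - u\<close> is either \<open>0\<close> or \<open>- 2 u\<^sub>i\<close>. Hence their inner product
  is nonnegative, which bounds the angle by \<open>pi / 2\<close>, and the angle between \<open>v - u\<close> and \<open>- u\<close> is
  exactly \<open>arccos (sqrt (d\<^sub>1 / n))\<close>; similarly for \<open>w\<close>. The second bound is thus the triangle
  inequality for angles, applied with the intermediate direction \<open>- u\<close>.
\<close>

text \<open>Normalising brings angles into the form handled by \<open>arccos_inner_triangle\<close>.
  A zero vector fits too: \<open>sgn 0 = 0\<close> reproduces the value pi / 2.\<close>

lemma vector_angle_eq_arccos_sgn: "vector_angle x y = arccos (sgn x \<bullet> sgn y)"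
  by (simp add: vector_angle_def sgn_div_norm divide_inverse mult_ac)

lemma vector_angle_commute: "vector_angle x y = vector_angle y x"
  by (simp add: vector_angle_def inner_commute mult.commute)

lemma arccos_inner_triangle:
  fixes a b c :: "'a :: real_inner"
  assumes a: "norm a \<le> 1" and b: "norm b \<le> 1" and c: "norm c = 1"
  shows "arccos (a \<bullet> b) \<le> arccos (a \<bullet> c) + arccos (c \<bullet> b)"
proof -
  have bnd: "\<bar>p \<bullet> q\<bar> \<le> 1" if "norm p \<le> 1" "norm q \<le> 1" for p q :: 'a
    using Cauchy_Schwarz_ineq2[of p q] mult_mono[OF that] by simp
  have ab: "\<bar>a \<bullet> b\<bar> \<le> 1" and ac: "\<bar>a \<bullet> c\<bar> \<le> 1" and cb: "\<bar>c \<bullet> b\<bar> \<le> 1"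
    using bnd a b c by simp_all
  define a' b' where "a' = a - (a \<bullet> c) *\<^sub>R c" and "b' = b - (c \<bullet> b) *\<^sub>R c"
  have cc: "c \<bullet> c = 1"
    using c by (simp add: dot_square_norm)
  \<comment> \<open>Pythagoras; the right-hand side is the sine of
    \<open>arccos (p \<bullet> c)\<close>.\<close>
  have residual: "norm (p - (p \<bullet> c) *\<^sub>R c) \<le> sqrt (1 - (p \<bullet> c)\<^sup>2)" if "norm p \<le> 1" for p
  proof (rule real_le_rsqrt)
    have "(norm (p - (p \<bullet> c) *\<^sub>R c))\<^sup>2 = (norm p)\<^sup>2 - (p \<bullet> c)\<^sup>2"
      unfolding power2_norm_eq_inner
      by (simp add: inner_diff_left inner_diff_right inner_commute cc power2_eq_square)
    with that show "(norm (p - (p \<bullet> c) *\<^sub>R c))\<^sup>2 \<le> 1 - (p \<bullet> c)\<^sup>2"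
      by (simp add: power_le_one)
  qed
  have "norm a' * norm b' \<le> sqrt (1 - (a \<bullet> c)\<^sup>2) * sqrt (1 - (c \<bullet> b)\<^sup>2)"
    using residual[OF a] residual[OF b] ac unfolding a'_def b'_def
    by (intro mult_mono) (auto simp: inner_commute abs_square_le_1)
  moreover have "- (norm a' * norm b') \<le> a' \<bullet> b'"
    using Cauchy_Schwarz_ineq2[of a' b'] by linarith
  moreover have "a \<bullet> b = (a \<bullet> c) * (c \<bullet> b) + a' \<bullet> b'"
    unfolding a'_def b'_def
    by (simp add: inner_diff_left inner_diff_right inner_commute cc)
  moreover have "cos (arccos (a \<bullet> c) + arccos (c \<bullet> b)) =
      (a \<bullet> c) * (c \<bullet> b) - sqrt (1 - (a \<bullet> c)\<^sup>2) * sqrt (1 - (c \<bullet> b)\<^sup>2)"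
    using ac cb by (simp add: cos_add cos_arccos_abs sin_arccos_abs)
  ultimately have le: "cos (arccos (a \<bullet> c) + arccos (c \<bullet> b)) \<le> a \<bullet> b"
    by linarith
  have nonneg: "0 \<le> arccos (a \<bullet> c) + arccos (c \<bullet> b)"
    using ac cb by (intro add_nonneg_nonneg arccos_lbound) auto
  \<comment> \<open>arccos inverts cos only on [0, pi]; when the sum exceeds pi, the bound is
    trivial.\<close>
  show ?thesis
  proof (cases "arccos (a \<bullet> c) + arccos (c \<bullet> b) \<le> pi")
    case True
    have "arccos (a \<bullet> b) \<le> arccos (cos (arccos (a \<bullet> c) + arccos (c \<bullet> b)))"
      using le ab by (intro arccos_le_arccos) auto
    with True nonneg show ?thesis
      by (simp add: arccos_cos)
  next
    case False
    moreover have "arccos (a \<bullet> b) \<le> pi"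
      using ab by (intro arccos_ubound) auto
    ultimately show ?thesis by linarith
  qed
qed

lemma vector_angle_triangle:
  assumes "z \<noteq> 0"
  shows "vector_angle x y \<le> vector_angle x z + vector_angle z y"
  unfolding vector_angle_eq_arccos_sgn
  using assms by (intro arccos_inner_triangle) (simp_all add: norm_sgn)

lemma vector_angle_le_pi_half:
  assumes "0 \<le> x \<bullet> y"
  shows "vector_angle x y \<le> pi / 2"
  unfolding vector_angle_def
  using assms abs_inner_div_norm_le_1[of x y] by (intro arccos_le_pi2) auto

lemma sign_vector_norm:
  fixes u :: "real ^ 'n"
  assumes "\<forall>i. u $ i \<in> {-1, 1}"
  shows "norm u = sqrt CARD('n)"
proof -
  have "u $ i * u $ i = 1" for i
    using assms[rule_format, of i] by auto
  then show ?thesis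
    by (simp add: norm_eq_sqrt_inner inner_vec_def)
qed

lemma sign_vector_diff_nth:
  fixes u v :: "real ^ 'n"
  assumes "\<forall>i. u $ i \<in> {-1, 1}" and "\<forall>i. v $ i \<in> {-1, 1}"
  shows "(v - u) $ i = (if u $ i \<noteq> v $ i then - 2 * u $ i else 0)"
  using assms(1)[rule_format, of i] assms(2)[rule_format, of i] by auto

text \<open>Each differing coordinate adds 2 to the inner product and 4 to the squared norm of
  \<open>v - u\<close>, so the cosine is 2 d / (2 sqrt d sqrt n).\<close>

lemma vector_angle_sign_vector_diff:
  fixes u v :: "real ^ 'n"
  assumes u: "\<forall>i. u $ i \<in> {-1, 1}" and v: "\<forall>i. v $ i \<in> {-1, 1}"
  shows "vector_angle (v - u) (- u) = arccos (sqrt (real (hamming_dist u v) / real CARD('n)))"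
proof -
  define d where "d = real (hamming_dist u v)"
  have uu: "u $ i * u $ i = 1" for i
    using u[rule_format, of i] by auto
  have d: "d = (\<Sum>i\<in>UNIV. if u $ i \<noteq> v $ i then 1 else 0)"
    unfolding d_def hamming_dist_def by (simp add: sum.If_cases)
  have "(v - u) \<bullet> (- u) = (\<Sum>i\<in>UNIV. 2 * (if u $ i \<noteq> v $ i then 1 else 0))"
    unfolding inner_vec_def
    \<comment> \<open>Keeping \<open>(v - u) $ i\<close> unexpanded lets
      \<open>sign_vector_diff_nth\<close> rewrite it.\<close>
    by (intro sum.cong refl) (simp add: sign_vector_diff_nth[OF u v] uu del: vector_minus_component)
  then have inner: "(v - u) \<bullet> (- u) = 2 * d"
    by (simp add: d sum_distrib_left)
  have "(v - u) \<bullet> (v - u) = (\<Sum>i\<in>UNIV. 4 * (if u $ i \<noteq> v $ i then 1 else 0))"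
    unfolding inner_vec_def
    by (intro sum.cong refl) (simp add: sign_vector_diff_nth[OF u v] uu del: vector_minus_component)
  then have "(v - u) \<bullet> (v - u) = 4 * d"
    by (simp add: d sum_distrib_left)
  then have "norm (v - u) = 2 * sqrt d"
    by (simp add: norm_eq_sqrt_inner real_sqrt_mult)
  then have "(v - u) \<bullet> (- u) / (norm (v - u) * norm (- u)) = d / sqrt d / sqrt CARD('n)"
    by (simp add: inner sign_vector_norm[OF u] del: inner_minus_right)
  \<comment> \<open>For \<open>d = 0\<close> this relies on \<open>0 / 0 = 0\<close>.\<close>
  also have "\<dots> = sqrt (d / CARD('n))"
    by (simp add: d_def real_div_sqrt real_sqrt_divide)
  finally show ?thesis
    by (simp add: vector_angle_def d_def)
qed

text \<open>Both differences are 0 or \<open>- 2 * u $ i\<close> in coordinate \<open>i\<close>, so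
  each product is 0 or 4.\<close>

lemma inner_sign_vector_diff_nonneg:
  fixes u v w :: "real ^ 'n"
  assumes u: "\<forall>i. u $ i \<in> {-1, 1}"
    and v: "\<forall>i. v $ i \<in> {-1, 1}"
    and w: "\<forall>i. w $ i \<in> {-1, 1}"
  shows "0 \<le> (v - u) \<bullet> (w - u)"
  unfolding inner_vec_def
  by (intro sum_nonneg)
    (simp add: sign_vector_diff_nth[OF u v] sign_vector_diff_nth[OF u w] del: vector_minus_component)

theorem lemma1:
  fixes u v w :: "real ^ 'n" and \<theta> :: real and d1 d2 :: nat
  assumes "\<forall>i. u $ i \<in> {-1, 1}"
    and "\<forall>i. v $ i \<in> {-1, 1}"
    and "\<forall>i. w $ i \<in> {-1, 1}"
    and "v \<noteq> u" and "w \<noteq> u"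
    and "\<theta> = vector_angle (v - u) (w - u)"
    and "d1 = hamming_dist u v" and "d2 = hamming_dist u w"
  shows "\<theta> \<le> min (pi / 2)
    (arccos (sqrt (real d1 / real CARD('n))) + arccos (sqrt (real d2 / real CARD('n))))"
proof -
  \<comment> \<open>The norm of \<open>u\<close> is sqrt n, positive because index types are
    nonempty.\<close>
  have "- u \<noteq> 0"
    using sign_vector_norm[OF assms(1)] by auto
  then have "\<theta> \<le> vector_angle (v - u) (- u) + vector_angle (w - u) (- u)"
    using vector_angle_triangle[of "- u" "v - u" "w - u"] vector_angle_commute[of "- u" "w - u"]
      assms(6) by simp
  moreover have "\<theta> \<le> pi / 2"
    unfolding assms(6)
    by (intro vector_angle_le_pi_half inner_sign_vector_diff_nonneg assms)
  ultimately show ?thesis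
    unfolding vector_angle_sign_vector_diff[OF assms(1,2)] vector_angle_sign_vector_diff[OF assms(1,3)]
    by (simp add: assms(7,8))
qed

end
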